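(* For every integer $r\ge1$, the polytope $\mathcal P_{2r}^{(1)}$ is Gorenstein; equivalently, its $h^*$-polynomial is palindromic.
   Context: For integers $d\ge2$ and $s\ge1$ let $$\mathcal P_d^{(s)}=\{x=(x_1,\dots,x_d)\in\mathbb R_{\ge0}^d:\ x_i+x_{i+1}\le s+\delta_i,\ 1\le i\le d-1\},$$ where $\delta_i=0$ for $i$ odd and $\delta_i=1$ for $i$ even; this is a full-dimensional lattice polytope. A full-dimensional lattice polytope $\mathcal P\subset\mathbb R^d$ is Gorenstein (of index $k$) if there are an integer $k\ge1$ and $c\in\mathbb Z^d$ with $\operatorname{int}((n+k)\mathcal P)\cap\mathbb Z^d=c+(n\mathcal P\cap\mathbb Z^d)$ for all integers $n\ge0$. The $h^*$-polynomial $h^*(z)$ of $\mathcal P$ is defined by $\sum_{m\ge0}\#(m\mathcal P\cap\mathbb Z^d)z^m=h^*(z)/(1-z)^{d+1}$; it is palindromic if $z^{\deg h^*}h^*(1/z)=h^*(z)$. By the Stanley–Hibi theorem the two properties are equivalent. *)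

theory Defs
  imports "HOL-Analysis.Analysis" "HOL-Computational_Algebra.Polynomial_FPS"
begin

definition lattice_points :: "(real ^ 'n) set" where
  "lattice_points = {x. \<forall>i. x $ i \<in> \<int>}"

definition dilate :: "nat \<Rightarrow> (real ^ 'n) set \<Rightarrow> (real ^ 'n) set" where
  "dilate m P = (\<lambda>x. real m *\<^sub>R x) ` P"

definition full_dim_lattice_polytope :: "(real ^ 'n) set \<Rightarrow> bool" where
  "full_dim_lattice_polytope P \<longleftrightarrow>
     (\<exists>V. finite V \<and> V \<subseteq> lattice_points \<and> P = convex hull V) \<and>
     aff_dim P = int CARD('n)"

definition gorenstein :: "(real ^ 'n) set \<Rightarrow> bool" where
  "gorenstein P \<longleftrightarrow>
     full_dim_lattice_polytope P \<and>
     (\<exists>k\<ge>1. \<exists>c\<in>lattice_points. \<forall>n.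
        interior (dilate (n + k) P) \<inter> lattice_points =
        (\<lambda>x. c + x) ` (dilate n P \<inter> lattice_points))"

definition ehrhart :: "(real ^ 'n) set \<Rightarrow> nat \<Rightarrow> nat" where
  "ehrhart P m = card (dilate m P \<inter> lattice_points)"

text \<open>The \<open>h\<^sup>*\<close>-polynomial as a relation, so that asserting it of some \<open>h\<close> includes
  that the numerator of the Ehrhart series is a polynomial at all; the lemma below says
  that there is at most one such \<open>h\<close>.\<close>

definition is_h_star_poly :: "(real ^ 'n) set \<Rightarrow> real poly \<Rightarrow> bool" where
  "is_h_star_poly P h \<longleftrightarrow>
     Abs_fps (\<lambda>m. real (ehrhart P m)) = fps_of_poly h / (1 - fps_X) ^ (CARD('n) + 1)"

lemma is_h_star_poly_unique:
  assumes "is_h_star_poly P h" "is_h_star_poly P h'"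
  shows "h = h'"
proof -
  let ?q = "(1 - fps_X :: real fps) ^ (CARD('a) + 1)"
  have u: "is_unit ?q"
    by (simp add: fps_is_unit_iff fps_nth_power_0)
  have "fps_of_poly h div ?q = fps_of_poly h' div ?q"
    using assms by (simp add: is_h_star_poly_def)
  then have "fps_of_poly h = fps_of_poly h'"
    using unit_div_cancel[OF u] by blast
  then show ?thesis
    by (simp add: fps_of_poly_eq_iff)
qed

text \<open>\<open>reflect_poly h\<close> is \<open>z ^ degree h * h (1 / z)\<close>.\<close>

definition palindromic_poly :: "real poly \<Rightarrow> bool" where
  "palindromic_poly h \<longleftrightarrow> reflect_poly h = h"

definition delta :: "nat \<Rightarrow> nat" where
  "delta i = (if odd i then 0 else 1)"

text \<open>The \<open>d = CARD('n)\<close> coordinates are numbered by \<open>e\<close>, meant to be a bijection from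
  \<open>{1..d}\<close> to the index type: \<open>x $ e i\<close> is the \<open>i\<close>-th coordinate of \<open>x\<close>.\<close>

definition P_polytope :: "(nat \<Rightarrow> 'n) \<Rightarrow> nat \<Rightarrow> (real ^ 'n) set" where
  "P_polytope e s = {x.
     (\<forall>i\<in>{1..CARD('n)}. 0 \<le> x $ e i) \<and>
     (\<forall>i\<in>{1..CARD('n) - 1}. x $ e i + x $ e (i + 1) \<le> real (s + delta i))}"

end

theory Submission imports Defs begin

text \<open>
  For \<open>d = 2 r\<close> and \<open>s = 1\<close> the constraints \<open>x\<^sub>i + x\<^sub>i\<^sub>+\<^sub>1 \<le> 2\<close> with \<open>i\<close> even are redundant: since \<open>d\<close>
  is even, every coordinate occurs in some constraint \<open>x\<^sub>i + x\<^sub>i\<^sub>+\<^sub>1 \<le> 1\<close> with \<open>i\<close> odd and is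
  therefore at most \<open>1\<close>. What is left couples the coordinates only within the pairs
  \<open>(x\<^sub>1, x\<^sub>2), (x\<^sub>3, x\<^sub>4), \<dots>\<close>, so the polytope is a product of \<open>r\<close> unimodular triangles
  (\<open>P_polytope_eq_triangles\<close>).

  The interior lattice points of the triangle \<open>a, b \<ge> 0\<close>, \<open>a + b \<le> n + 3\<close> are those with
  \<open>a, b \<ge> 1\<close>, \<open>a + b \<le> n + 2\<close>, that is, the lattice points of the \<open>n\<close>-th dilate shifted by
  \<open>(1, 1)\<close>. Taking products, the polytope is Gorenstein of index \<open>3\<close> with the all-ones vector as
  shift (\<open>gorenstein_triangles\<close>). Its vertices are \<open>0/1\<close>-vectors because a point whose pair
  \<open>(a, b)\<close> is not a vertex of the triangle is a proper convex combination of the three points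
  obtained by replacing that pair with the vertices (\<open>extreme_point_triangles\<close>).

  For the numerator of the Ehrhart series, the general Stanley--Hibi theorem is replaced by a
  computation with the explicit counting polynomial \<open>f(m) = ((m + 1) (m + 2) / 2) ^ r\<close>. It
  satisfies \<open>f(-3 - m) = f(m)\<close> and vanishes at \<open>-1\<close> and \<open>-2\<close>. The coefficients of
  \<open>(1 - z) ^ (d + 1) * (\<Sum>m. f(m) z ^ m)\<close> are initial segments of the alternating binomial sums
  that compute \<open>(d + 1)\<close>-st finite differences of \<open>f\<close>. As \<open>f\<close> has degree at most \<open>d\<close>, each full
  sum is zero, so an initial segment is minus the remaining segment; reversing the latter by the
  symmetry of \<open>f\<close> gives an initial segment again, and this is palindromicity
  (\<open>palindromic_numerator\<close>).
\<close>

section \<open>Palindromic numerators from reciprocity\<close>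

text \<open>Finite differences of order above the degree vanish. Induction on the polynomial through
  \<open>pCons a p = a + X p\<close> works because, writing \<open>X = x - k\<close>, the factor \<open>k\<close> is absorbed by
  \<open>k * (N choose k) = N * (N - 1 choose k - 1)\<close>, which leaves sums of the same kind for \<open>p\<close>, of
  order \<open>N\<close> and \<open>N - 1\<close>.\<close>

lemma alternating_binomial_sum_poly:
  fixes p :: "'a::{comm_ring_1,semiring_no_zero_divisors} poly"
  assumes "degree p < N"
  shows "(\<Sum>k\<le>N. (-1) ^ k * of_nat (N choose k) * poly p (x - of_nat k)) = 0"
  using assms
proof (induction p arbitrary: N x)
  case 0
  then show ?case by simp
next
  case (pCons a p)
  then obtain M where M: "N = Suc M" by (cases N) auto
  have const: "(\<Sum>k\<le>N. (-1) ^ k * of_nat (N choose k) * a) = 0"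
    using choose_alternating_sum[of N, where 'a='a] M by (simp flip: sum_distrib_right)
  show ?case
  proof (cases "p = 0")
    case True
    then show ?thesis using const by simp
  next
    case False
    with pCons.prems M have deg: "degree p < M" by simp
    have absorb: "(\<Sum>k\<le>N. (-1) ^ k * of_nat (N choose k) * (of_nat k * poly p (x - of_nat k)))
      = - of_nat N * (\<Sum>k\<le>M. (-1) ^ k * of_nat (M choose k) * poly p ((x - 1) - of_nat k))"
    proof -
      have c: "of_nat (Suc M choose Suc k) * (of_nat (Suc k) * y) =
          of_nat (Suc M) * (of_nat (M choose k) * y)" for k and y :: 'a
        using Suc_times_binomial[of k M]
        by (metis (no_types, lifting) mult.assoc mult.commute of_nat_mult)
      have "(\<Sum>k\<le>N. (-1) ^ k * of_nat (N choose k) * (of_nat k * poly p (x - of_nat k)))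
        = (\<Sum>k\<le>M. (-1) ^ Suc k *
            (of_nat (Suc M choose Suc k) * (of_nat (Suc k) * poly p (x - of_nat (Suc k)))))"
        unfolding M by (subst sum.atMost_Suc_shift) (simp add: mult.assoc del: binomial_Suc_Suc)
      also have "\<dots> = (\<Sum>k\<le>M. - of_nat N * ((-1) ^ k * of_nat (M choose k) * poly p ((x - 1) - of_nat k)))"
        unfolding c by (intro sum.cong refl) (simp add: M algebra_simps)
      finally show ?thesis by (simp only: sum_distrib_left)
    qed
    have "(\<Sum>k\<le>N. (-1) ^ k * of_nat (N choose k) * poly (pCons a p) (x - of_nat k))
      = (\<Sum>k\<le>N. (-1) ^ k * of_nat (N choose k) * a)
        + x * (\<Sum>k\<le>N. (-1) ^ k * of_nat (N choose k) * poly p (x - of_nat k))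
        - (\<Sum>k\<le>N. (-1) ^ k * of_nat (N choose k) * (of_nat k * poly p (x - of_nat k)))"
      unfolding sum_distrib_left by (simp add: sum.distrib sum_subtractf algebra_simps)
    also have "\<dots> = 0"
      using const absorb pCons.IH[OF deg, of "x - 1"] pCons.IH[of N x] deg M by simp
    finally show ?thesis .
  qed
qed

text \<open>The hypotheses on \<open>p\<close> are what Ehrhart reciprocity gives for the counting polynomial of a
  \<open>d\<close>-dimensional Gorenstein polytope of index \<open>c\<close>: \<open>p\<close> counts the same at \<open>- c - m\<close> as at \<open>m\<close>, up
  to the sign \<open>(-1) ^ d\<close>, and the dilates by \<open>1, \<dots>, c - 1\<close> have no interior lattice points. The
  numerator then has degree \<open>d + 1 - c\<close>.\<close>

lemma palindromic_numerator:
  fixes p :: "real poly" and d c :: nat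
  assumes deg: "degree p \<le> d" and c: "1 \<le> c" "c \<le> d + 1"
    and sym: "\<And>x. poly p (- of_nat c - x) = (-1) ^ d * poly p x"
    and zeros: "\<And>i. 0 < i \<Longrightarrow> i < c \<Longrightarrow> poly p (- real i) = 0"
    and p0: "poly p 0 \<noteq> 0"
  shows "\<exists>h. Abs_fps (\<lambda>m. poly p (real m)) = fps_of_poly h / (1 - fps_X) ^ (d + 1)
    \<and> palindromic_poly h"
proof -
  let ?F = "Abs_fps (\<lambda>m. poly p (real m))"
  define D where "D = d + 1 - c"
  define t where "t j k = (-1) ^ k * of_nat ((d + 1) choose k) * poly p (real j - real k)" for j k :: nat
  define H where "H j = (\<Sum>k\<le>j. t j k)" for j
  have pow: "fps_nth ((1 - fps_X) ^ (d + 1) :: real fps) k = (-1) ^ k * of_nat ((d + 1) choose k)" for k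
  proof -
    have "((1 - fps_X) ^ (d + 1) :: real fps) = (1 - fps_const 1 * fps_X) ^ (d + 1)" by simp
    also have "\<dots> = fps_compose (fps_binomial (of_nat (d + 1))) (fps_const (-1) * fps_X)"
      by (subst one_minus_const_fps_X_power) (simp_all flip: fps_const_neg)
    finally show ?thesis by (simp only: fps_compose_linear) (simp add: binomial_gbinomial)
  qed
  have coeff: "fps_nth ((1 - fps_X) ^ (d + 1) * ?F) j = H j" for j
    unfolding H_def fps_mult_nth t_def pow
    by (intro sum.cong) (auto simp: of_nat_diff)
  \<comment> \<open>The full alternating sum over \<open>k\<close> vanishes, and so do the terms with \<open>j < k < j + c\<close>, in
    which \<open>p\<close> is evaluated at one of \<open>-1, \<dots>, -(c - 1)\<close>.\<close>
  have H_tail: "H j = - (\<Sum>k = j + c..d + 1. t j k)" for j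
  proof -
    \<comment> \<open>The range is extended beyond \<open>d + 1\<close>, where the binomials are zero, so that it contains
      \<open>{..j}\<close> for every \<open>j\<close>.\<close>
    have "(\<Sum>k\<le>d + 1 + j + c. t j k) = (\<Sum>k\<le>d + 1. t j k)"
      by (intro sum.mono_neutral_right) (auto simp: t_def)
    also have "\<dots> = 0"
      using alternating_binomial_sum_poly[of p "d + 1" "real j"] deg unfolding t_def by simp
    finally have "(\<Sum>k\<le>d + 1 + j + c. t j k) = 0" .
    moreover have "(\<Sum>k\<le>d + 1 + j + c. t j k) = H j + (\<Sum>k\<in>{j<..d + 1 + j + c}. t j k)"
    proof -
      have "{..d + 1 + j + c} = {..j} \<union> {j<..d + 1 + j + c}" by auto
      then show ?thesis unfolding H_def by (simp only:) (rule sum.union_disjoint; auto)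
    qed
    moreover have "(\<Sum>k\<in>{j<..d + 1 + j + c}. t j k) = (\<Sum>k = j + c..d + 1. t j k)"
    proof (intro sum.mono_neutral_right ballI)
      fix k assume k: "k \<in> {j<..d + 1 + j + c} - {j + c..d + 1}"
      show "t j k = 0"
      proof (cases "k < j + c")
        case True
        then show ?thesis using zeros[of "k - j"] k by (simp add: t_def of_nat_diff)
      next
        case False
        then show ?thesis using k by (simp add: t_def)
      qed
    qed (use c in auto)
    ultimately show ?thesis by simp
  qed
  have H_zero: "H j = 0" if "j > D" for j
    using that c unfolding H_tail D_def by simp
  \<comment> \<open>The substitution \<open>k = d + 1 - i\<close> turns the tail for \<open>j\<close> into the initial segment for
    \<open>D - j\<close>: the arguments of \<open>p\<close> correspond under \<open>x \<mapsto> - c - x\<close>.\<close>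
  have H_sym: "H (D - j) = H j" if j: "j \<le> D" for j
  proof -
    have "(\<Sum>k = j + c..d + 1. t j k) = (\<Sum>i\<le>D - j. t j (d + 1 - i))"
      by (rule sum.reindex_bij_witness[of _ "\<lambda>i. d + 1 - i" "\<lambda>k. d + 1 - k"])
        (use j c in \<open>auto simp: D_def\<close>)
    also have "\<dots> = (\<Sum>i\<le>D - j. - t (D - j) i)"
    proof (intro sum.cong refl)
      fix i assume i: "i \<in> {..D - j}"
      then have le: "i \<le> d + 1" by (simp add: D_def)
      have arg: "real j - real (d + 1 - i) = - of_nat c - (real (D - j) - real i)"
        using i j c by (simp add: D_def of_nat_diff)
      have sign: "(-1::real) ^ (d + 1 - i) * (-1) ^ d = - ((-1) ^ i)"
      proof -
        have "odd (d + 1 - i + d) \<longleftrightarrow> even i" using le by presburger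
        then show ?thesis
          by (cases "even i") (simp_all flip: power_add)
      qed
      have "t j (d + 1 - i) = ((-1) ^ (d + 1 - i) * (-1) ^ d)
          * (of_nat ((d + 1) choose i) * poly p (real (D - j) - real i))"
        unfolding t_def arg sym binomial_symmetric[OF le] by (simp only: mult.assoc mult.left_commute)
      then show "t j (d + 1 - i) = - t (D - j) i"
        unfolding sign t_def by (simp only: mult.assoc mult_minus_left)
    qed
    finally show ?thesis by (simp add: H_tail[of j] H_def[of "D - j"] sum_negf)
  qed
  define h where "h = Abs_poly H"
  have h: "coeff h j = H j" for j
    unfolding h_def by (subst coeff_Abs_poly[of D]) (auto simp: H_zero)
  have "fps_of_poly h = (1 - fps_X) ^ (d + 1) * ?F"
    by (intro fps_ext) (simp only: fps_of_poly_nth h coeff)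
  then have "?F = fps_of_poly h / (1 - fps_X) ^ (d + 1)"
    by (simp add: fps_nth_power_0 del: power_Suc)
  moreover have "palindromic_poly h"
  proof -
    have "H 0 \<noteq> 0" using p0 by (simp add: H_def t_def)
    then have "coeff h D \<noteq> 0" using H_sym[of 0] by (simp add: h)
    then have "degree h = D"
      by (intro antisym le_degree degree_le) (auto simp: h H_zero)
    then show ?thesis
      unfolding palindromic_poly_def
      by (intro poly_eqI) (auto simp: coeff_reflect_poly h H_zero H_sym)
  qed
  ultimately show ?thesis by blast
qed

section \<open>Products of triangles\<close>

lemma card_nat_triangle: "2 * card {(a, b). a + b \<le> m} = (m + 1) * (m + 2)" for m :: nat
proof -
  have "{(a, b). a + b \<le> m} = (SIGMA a:{..m}. {..m - a})" by auto
  then have "card {(a, b). a + b \<le> m} = (\<Sum>a\<le>m. Suc (m - a))" by simp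
  also have "\<dots> = (\<Sum>a\<le>m. Suc a)"
    using sum.nat_diff_reindex[of Suc "Suc m"] by (simp add: lessThan_Suc_atMost)
  also have "2 * \<dots> = (m + 1) * (m + 2)" by (induction m) auto
  finally show ?thesis by simp
qed

text \<open>The coordinates are grouped into \<open>r\<close> pairs, \<open>p (j, False)\<close> and \<open>p (j, True)\<close> being
  the two members of pair \<open>j\<close>. The Boolean component makes the pairing a single bijection onto
  the index type, so that statements about points can be checked pair by pair.\<close>

locale coordinate_pairing =
  fixes r :: nat and p :: "nat \<times> bool \<Rightarrow> 'n::finite"
  assumes bij: "bij_betw p ({..<r} \<times> UNIV) UNIV"
begin

definition triangles :: "real \<Rightarrow> (real ^ 'n) set" where
  "triangles N = {x. (\<forall>i. 0 \<le> x $ i) \<and> (\<forall>j<r. x $ p (j, False) + x $ p (j, True) \<le> N)}"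

lemma p_eq_iff: "j < r \<Longrightarrow> j' < r \<Longrightarrow> p (j, b) = p (j', b') \<longleftrightarrow> j = j' \<and> b = b'"
  using inj_on_eq_iff[OF bij_betw_imp_inj_on[OF bij], of "(j, b)" "(j', b')"] by simp

lemma index_cases:
  obtains j b where "j < r" "i = p (j, b)"
proof -
  have "i \<in> p ` ({..<r} \<times> UNIV)" using bij by (simp add: bij_betw_def)
  then show ?thesis using that by auto
qed

lemma card_index: "CARD('n) = 2 * r"
  using bij_betw_same_card[OF bij] by (simp add: card_cartesian_product)

lemma triangles_le:
  assumes "x \<in> triangles N"
  shows "x $ i \<le> N"
proof -
  obtain j b where "j < r" "i = p (j, b)" by (rule index_cases)
  with assms have "0 \<le> x $ p (j, False)" "0 \<le> x $ p (j, True)"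
    "x $ p (j, False) + x $ p (j, True) \<le> N" "i = p (j, False) \<or> i = p (j, True)"
    by (auto simp: triangles_def intro: bool.exhaust[of b])
  then show ?thesis by auto
qed

lemma dilate_triangles: "dilate m (triangles 1) = triangles (real m)"
proof (intro equalityI subsetI)
  fix x assume "x \<in> dilate m (triangles 1)"
  then obtain y where y: "y \<in> triangles 1" "x = real m *\<^sub>R y" by (auto simp: dilate_def)
  then show "x \<in> triangles (real m)"
    by (auto simp: triangles_def mult_left_le simp flip: distrib_left)
next
  fix x assume x: "x \<in> triangles (real m)"
  have "x = real m *\<^sub>R (inverse (real m) *\<^sub>R x)"
  proof (cases "m = 0")
    case True
    have "x $ i = 0" for i
      using triangles_le[OF x, of i] x True by (auto simp: triangles_def intro: antisym)
    then show ?thesis by (simp add: vec_eq_iff)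
  qed simp
  moreover have "inverse (real m) *\<^sub>R x \<in> triangles 1"
    using x by (cases "m = 0") (auto simp: triangles_def field_simps)
  ultimately show "x \<in> dilate m (triangles 1)" unfolding dilate_def by blast
qed

text \<open>The description by half-spaces, from which convexity, closedness and the interior are
  read off.\<close>

lemma triangles_eq_Inter:
  "triangles N = (\<Inter>i. {x. 0 \<le> x $ i}) \<inter>
    (\<Inter>j\<in>{..<r}. {x. (axis (p (j, False)) 1 + axis (p (j, True)) 1) \<bullet> x \<le> N})"
  by (auto simp: triangles_def inner_add_left inner_axis')

lemma interior_triangles:
  "interior (triangles N) =
    {x. (\<forall>i. 0 < x $ i) \<and> (\<forall>j<r. x $ p (j, False) + x $ p (j, True) < N)}"
    (is "_ = ?U")
proof
  let ?a = "\<lambda>j. axis (p (j, False)) 1 + axis (p (j, True)) 1 :: real ^ 'n"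
  have U: "?U = (\<Inter>i. {x. 0 < x $ i}) \<inter> (\<Inter>j\<in>{..<r}. {x. ?a j \<bullet> x < N})"
    by (auto simp: inner_add_left inner_axis')
  have "open ?U" unfolding U
    by (intro open_Int open_INT ballI open_halfspace_lt open_halfspace_component_gt_cart) auto
  moreover have "?U \<subseteq> triangles N" by (auto simp: triangles_def intro: less_imp_le)
  ultimately show "?U \<subseteq> interior (triangles N)" by (rule interior_maximal[rotated])
  show "interior (triangles N) \<subseteq> ?U"
  proof
    fix x assume x: "x \<in> interior (triangles N)"
    have "0 < x $ i" for i
    proof -
      have "interior (triangles N) \<subseteq> interior {x. 0 \<le> x $ i}"
        by (rule interior_mono) (auto simp: triangles_def)
      then show ?thesis using x by auto
    qed
    moreover have "x $ p (j, False) + x $ p (j, True) < N" if j: "j < r" for j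
    proof -
      have "?a j $ p (j, False) \<noteq> 0" using j by (simp add: axis_def p_eq_iff)
      then have "?a j \<noteq> 0" by (metis zero_index)
      then have "interior {x. ?a j \<bullet> x \<le> N} = {x. ?a j \<bullet> x < N}"
        by (rule interior_halfspace_le)
      moreover have "interior (triangles N) \<subseteq> interior {x. ?a j \<bullet> x \<le> N}"
        by (rule interior_mono) (use j in \<open>auto simp: triangles_eq_Inter\<close>)
      ultimately show ?thesis using x by (auto simp: inner_add_left inner_axis')
    qed
    ultimately show "x \<in> ?U" by blast
  qed
qed

lemma convex_triangles: "convex (triangles N)"
  unfolding triangles_eq_Inter
  by (intro convex_Int convex_INT convex_halfspace_le) (simp add: convex_def)

lemma compact_triangles: "compact (triangles N)"
proof -
  have "closed (triangles N)" unfolding triangles_eq_Inter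
    by (intro closed_Int closed_INT ballI closed_halfspace_le closed_halfspace_component_ge_cart)
  moreover have "triangles N \<subseteq> cbox 0 (\<chi> i. N)"
    by (auto simp: mem_box_cart triangles_le) (auto simp: triangles_def)
  ultimately show ?thesis
    using bounded_cbox bounded_subset compact_eq_bounded_closed by blast
qed

text \<open>Any point of the product lies in the convex hull of the three points obtained by moving
  one of its pairs to the vertices \<open>(0, 0)\<close>, \<open>(1, 0)\<close> and \<open>(0, 1)\<close> of the triangle; an extreme
  point must be one of the three.\<close>

lemma extreme_point_triangles:
  assumes x: "x extreme_point_of triangles 1"
  shows "x $ i = 0 \<or> x $ i = 1"
proof -
  obtain j b where j: "j < r" and i: "i = p (j, b)" by (rule index_cases)
  define k l where "k = p (j, False)" and "l = p (j, True)"
  have kl: "k \<noteq> l" using j by (simp add: k_def l_def p_eq_iff)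
  have xT: "x \<in> triangles 1" using x by (simp add: extreme_point_of_def)
  define z where "z = (\<chi> m. if m = k \<or> m = l then 0 else x $ m)"
  let ?V = "{z, z + axis k 1, z + axis l 1}"
  have "x = z + x $ k *\<^sub>R ((z + axis k 1) - z) + x $ l *\<^sub>R ((z + axis l 1) - z)"
    using kl by (auto simp: vec_eq_iff z_def axis_def)
  moreover have "0 \<le> x $ k" "0 \<le> x $ l" "x $ k + x $ l \<le> 1"
    using xT j by (auto simp: triangles_def k_def l_def)
  ultimately have xV: "x \<in> convex hull ?V" unfolding convex_hull_3_alt by blast
  have "?V \<subseteq> triangles 1"
    using xT j by (auto simp: triangles_def z_def axis_def k_def l_def p_eq_iff)
  then have "convex hull ?V \<subseteq> triangles 1" by (simp add: hull_minimal convex_triangles)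
  then have "x extreme_point_of (convex hull ?V)"
    using x xV by (auto simp: extreme_point_of_def)
  then have "x \<in> ?V" by (rule extreme_point_of_convex_hull)
  moreover have "i = k \<or> i = l" using i by (cases b) (auto simp: k_def l_def)
  moreover have "w $ i = 0 \<or> w $ i = 1" if "w \<in> ?V" "i = k \<or> i = l" for w
    using that kl by (auto simp: z_def axis_def)
  ultimately show ?thesis by blast
qed

lemma full_dim_lattice_polytope_triangles: "full_dim_lattice_polytope (triangles 1)"
proof -
  let ?V = "{x. x extreme_point_of triangles 1}"
  have "?V \<subseteq> {x. \<forall>i. x $ i \<in> {0, 1}}" using extreme_point_triangles by blast
  moreover have "finite {x :: real ^ 'n. \<forall>i. x $ i \<in> {0, 1}}"
  proof (rule finite_subset)
    show "{x :: real ^ 'n. \<forall>i. x $ i \<in> {0, 1}} \<subseteq> range (\<lambda>A. \<chi> i. of_bool (i \<in> A))"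
    proof
      fix x :: "real ^ 'n" assume "x \<in> {x. \<forall>i. x $ i \<in> {0, 1}}"
      then have "x = (\<chi> i. of_bool (i \<in> {i. x $ i = 1}))" by (auto simp: vec_eq_iff)
      then show "x \<in> range (\<lambda>A. \<chi> i. of_bool (i \<in> A))" by blast
    qed
  qed simp
  ultimately have "finite ?V" by (rule finite_subset)
  moreover have "?V \<subseteq> lattice_points"
  proof
    fix x assume "x \<in> ?V"
    then have "x $ i \<in> \<int>" for i using extreme_point_triangles[of x i] by auto
    then show "x \<in> lattice_points" by (simp add: lattice_points_def)
  qed
  moreover have "triangles 1 = convex hull ?V"
    by (rule Krein_Milman_Minkowski[OF compact_triangles convex_triangles])
  moreover have "(\<chi> i. 1 / 3) \<in> interior (triangles 1)" by (simp add: interior_triangles)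
  then have "aff_dim (triangles 1) = int CARD('n)"
    by (subst aff_dim_nonempty_interior) auto
  ultimately show ?thesis unfolding full_dim_lattice_polytope_def by blast
qed

text \<open>An integer is positive iff it is at least \<open>1\<close>, and less than \<open>n + 3\<close> iff it is at most
  \<open>n + 2\<close>. Shifting both members of a pair down by \<open>1\<close> lowers their sum by \<open>2\<close>, so the open
  bound \<open>n + 3\<close> becomes the closed bound \<open>n\<close>.\<close>

lemma interior_lattice_points_triangles:
  "interior (triangles (real (n + 3))) \<inter> lattice_points
    = (\<lambda>x. (\<chi> i. 1) + x) ` (triangles (real n) \<inter> lattice_points)"
proof (intro equalityI subsetI)
  fix x assume x: "x \<in> interior (triangles (real (n + 3))) \<inter> lattice_points"
  have Ints: "x $ i \<in> \<int>" for i using x by (auto simp: lattice_points_def)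
  have ge: "1 \<le> x $ i" for i
  proof -
    have "0 < x $ i" using x by (auto simp: interior_triangles)
    then show ?thesis using Ints[of i] by (auto elim!: Ints_cases)
  qed
  have le: "x $ p (j, False) + x $ p (j, True) \<le> real n + 2" if "j < r" for j
  proof -
    obtain a b where ab: "x $ p (j, False) = of_int a" "x $ p (j, True) = of_int b"
      using Ints by (metis Ints_cases)
    have "x $ p (j, False) + x $ p (j, True) < real (n + 3)"
      using x that by (auto simp: interior_triangles)
    then have "real_of_int (a + b) < real_of_int (int n + 3)" by (simp add: ab)
    then have "a + b \<le> int n + 2" unfolding of_int_less_iff by simp
    then have "real_of_int (a + b) \<le> real_of_int (int n + 2)" unfolding of_int_le_iff .
    then show ?thesis by (simp add: ab)
  qed
  have "x - (\<chi> i. 1) \<in> triangles (real n) \<inter> lattice_points"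
    using ge Ints le by (auto simp: triangles_def lattice_points_def algebra_simps)
  then show "x \<in> (\<lambda>x. (\<chi> i. 1) + x) ` (triangles (real n) \<inter> lattice_points)"
    by (rule rev_image_eqI) simp
next
  fix x assume "x \<in> (\<lambda>x. (\<chi> i. 1) + x) ` (triangles (real n) \<inter> lattice_points)"
  then obtain y where x: "x = (\<chi> i. 1) + y" and y: "y \<in> triangles (real n)" "y \<in> lattice_points"
    by auto
  have "0 < x $ i" for i using y by (simp add: x triangles_def add_pos_nonneg)
  moreover have "x $ p (j, False) + x $ p (j, True) < real (n + 3)" if "j < r" for j
  proof -
    have "y $ p (j, False) + y $ p (j, True) \<le> real n" using y that by (simp add: triangles_def)
    then show ?thesis by (simp add: x)
  qed
  moreover have "x \<in> lattice_points" using y by (simp add: x lattice_points_def)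
  ultimately show "x \<in> interior (triangles (real (n + 3))) \<inter> lattice_points"
    by (simp add: interior_triangles)
qed

lemma gorenstein_triangles: "gorenstein (triangles 1)"
  unfolding gorenstein_def dilate_triangles
  using full_dim_lattice_polytope_triangles interior_lattice_points_triangles
  by (intro conjI exI[of _ 3] bexI[of _ "\<chi> i. 1"]) (auto simp: lattice_points_def)

text \<open>A lattice point of the dilate is the same as a choice, for each pair of coordinates, of a
  lattice point in the dilated triangle.\<close>

lemma card_lattice_points_triangles:
  "card (triangles (real m) \<inter> lattice_points) = card {(a, b). a + b \<le> m} ^ r"
proof -
  let ?T = "{(a, b). a + b \<le> m}"
  let ?f = "\<lambda>g. \<chi> i. case the_inv_into ({..<r} \<times> UNIV) p i of
    (j, b) \<Rightarrow> real (if b then snd (g j) else fst (g j))"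
  have f: "?f g $ p (j, b) = real (if b then snd (g j) else fst (g j))" if "j < r" for g j b
    using the_inv_into_f_f[OF bij_betw_imp_inj_on[OF bij], of "(j, b)"] that by simp
  have "bij_betw ?f ({..<r} \<rightarrow>\<^sub>E ?T) (triangles (real m) \<inter> lattice_points)"
  proof (intro bij_betw_imageI inj_onI equalityI subsetI)
    fix g g' assume g: "g \<in> {..<r} \<rightarrow>\<^sub>E ?T" "g' \<in> {..<r} \<rightarrow>\<^sub>E ?T" and eq: "?f g = ?f g'"
    have "g j = g' j" if "j < r" for j
      using f[OF that, of g True] f[OF that, of g False] f[OF that, of g' True]
        f[OF that, of g' False] eq by (simp add: prod_eq_iff)
    then show "g = g'" using g by (intro PiE_ext) auto
  next
    fix x assume "x \<in> ?f ` ({..<r} \<rightarrow>\<^sub>E ?T)"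
    then obtain g where g: "g \<in> {..<r} \<rightarrow>\<^sub>E ?T" and x: "x = ?f g" by blast
    have "fst (g j) + snd (g j) \<le> m" if "j < r" for j
      using PiE_mem[OF g, of j] that by auto
    then have "x $ p (j, False) + x $ p (j, True) \<le> real m" if "j < r" for j
      unfolding x f[OF that] using that by (simp flip: of_nat_add)
    moreover have "0 \<le> x $ i" "x $ i \<in> \<int>" for i
      by (auto simp: x split: prod.split)
    ultimately show "x \<in> triangles (real m) \<inter> lattice_points"
      by (simp add: triangles_def lattice_points_def)
  next
    fix x assume x: "x \<in> triangles (real m) \<inter> lattice_points"
    define c where "c i = nat \<lfloor>x $ i\<rfloor>" for i
    have c: "x $ i = real (c i)" for i
      using x by (auto simp: triangles_def lattice_points_def c_def)
    define g where "g = (\<lambda>j\<in>{..<r}. (c (p (j, False)), c (p (j, True))))"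
    have "c (p (j, False)) + c (p (j, True)) \<le> m" if "j < r" for j
    proof -
      have "real (c (p (j, False)) + c (p (j, True))) \<le> real m"
        using x that by (simp add: triangles_def flip: c)
      then show ?thesis by (simp only: of_nat_le_iff)
    qed
    then have "g \<in> {..<r} \<rightarrow>\<^sub>E ?T" by (auto simp: g_def)
    moreover have "x = ?f g"
    proof (subst vec_eq_iff, intro allI)
      fix i
      obtain j b where "j < r" "i = p (j, b)" by (rule index_cases)
      then show "x $ i = ?f g $ i" by (simp only: f) (simp add: g_def c)
    qed
    ultimately show "x \<in> ?f ` ({..<r} \<rightarrow>\<^sub>E ?T)" by blast
  qed
  then show ?thesis using bij_betw_same_card by (fastforce simp: card_PiE)
qed

text \<open>For \<open>r = 0\<close> the Ehrhart polynomial is the constant \<open>1\<close>, which does not vanish at \<open>-1\<close> and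
  \<open>-2\<close>.\<close>

lemma h_star_triangles:
  assumes "r \<ge> 1"
  shows "\<exists>h. is_h_star_poly (triangles 1) h \<and> palindromic_poly h"
proof -
  define q :: "real poly" where "q = [:1, 3/2, 1/2:] ^ r"
  have q: "poly q x = ((x + 1) * (x + 2) / 2) ^ r" for x
    by (simp add: q_def poly_power field_simps)
  have "real (ehrhart (triangles 1) m) = poly q (real m)" for m
  proof -
    have "real (2 * card {(a, b). a + b \<le> m}) = real ((m + 1) * (m + 2))"
      by (simp only: card_nat_triangle)
    then have *: "real (card {(a, b). a + b \<le> m}) = (real m + 1) * (real m + 2) / 2"
      by (simp add: algebra_simps)
    show ?thesis
      by (simp only: ehrhart_def dilate_triangles card_lattice_points_triangles q of_nat_power *)
  qed
  moreover have "\<exists>h. Abs_fps (\<lambda>m. poly q (real m)) = fps_of_poly h / (1 - fps_X) ^ (2 * r + 1)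
    \<and> palindromic_poly h"
  proof (rule palindromic_numerator[where c = 3])
    show "degree q \<le> 2 * r"
      unfolding q_def using degree_power_le[of "[:1, 3/2, 1/2::real:]" r] by simp
    show "poly q (- of_nat 3 - x) = (-1) ^ (2 * r) * poly q x" for x
      unfolding q by (simp add: field_simps)
    show "poly q (- real i) = 0" if "0 < i" "i < 3" for i
    proof -
      have "i = 1 \<or> i = 2" using that by auto
      then show ?thesis using assms by (auto simp: q)
    qed
  qed (use assms in \<open>auto simp: q\<close>)
  ultimately show ?thesis by (simp add: is_h_star_poly_def card_index)
qed

end

section \<open>The polytope as a product of triangles\<close>

definition consecutive_pairs :: "(nat \<Rightarrow> 'n) \<Rightarrow> nat \<times> bool \<Rightarrow> 'n" where
  "consecutive_pairs e = (\<lambda>(j, b). e (2 * j + 1 + of_bool b))"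

lemma coordinate_pairing_consecutive:
  fixes e :: "nat \<Rightarrow> 'n::finite"
  assumes "bij_betw e {1..2 * r} UNIV"
  shows "coordinate_pairing r (consecutive_pairs e)"
proof
  have "bij_betw (\<lambda>(j, b). 2 * j + 1 + of_bool b) ({..<r} \<times> UNIV) {1..2 * r}"
    by (rule bij_betw_byWitness[where f' = "\<lambda>k. ((k - 1) div 2, even k)"])
      (auto simp: of_bool_def elim!: evenE split: if_splits)
  from bij_betw_trans[OF this assms]
  show "bij_betw (consecutive_pairs e) ({..<r} \<times> UNIV) UNIV"
    by (simp add: consecutive_pairs_def comp_def case_prod_unfold)
qed

text \<open>In the product of triangles each coordinate is at most \<open>1\<close>, so the constraints with bound
  \<open>2\<close>, which link neighbouring pairs, hold automatically.\<close>

lemma P_polytope_eq_triangles: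
  fixes e :: "nat \<Rightarrow> 'n::finite"
  assumes "CARD('n) = 2 * r" and "bij_betw e {1..2 * r} UNIV"
  shows "P_polytope e 1
    = coordinate_pairing.triangles r (consecutive_pairs e) 1"
proof -
  interpret coordinate_pairing r "consecutive_pairs e"
    by (rule coordinate_pairing_consecutive[OF assms(2)])
  have nonneg: "(\<forall>i\<in>{1..2 * r}. 0 \<le> x $ e i) \<longleftrightarrow> (\<forall>i. 0 \<le> x $ i)" for x :: "real ^ 'n"
    using bij_betw_imp_surj_on[OF assms(2)] by (metis UNIV_I imageE)
  show ?thesis
  proof (intro equalityI subsetI)
    fix x assume "x \<in> P_polytope e 1"
    then have x: "\<forall>i. 0 \<le> x $ i"
      "\<And>i. i \<in> {1..2 * r - 1} \<Longrightarrow> x $ e i + x $ e (i + 1) \<le> real (1 + delta i)"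
      unfolding P_polytope_def assms(1) nonneg by blast+
    have "x $ e (2 * j + 1) + x $ e (2 * j + 2) \<le> 1" if "j < r" for j
      using x(2)[of "2 * j + 1"] that by (simp add: delta_def)
    with x(1) show "x \<in> triangles 1"
      unfolding triangles_def by (simp add: consecutive_pairs_def)
  next
    fix x assume x: "x \<in> triangles 1"
    have "x $ e i + x $ e (i + 1) \<le> real (1 + delta i)" if i: "i \<in> {1..2 * r - 1}" for i
    proof (cases "odd i")
      case True
      then obtain j where j: "i = 2 * j + 1" by (rule oddE)
      then have "j < r" using i by auto
      with x have "x $ e (2 * j + 1) + x $ e (2 * j + 2) \<le> 1"
        unfolding triangles_def by (auto simp: consecutive_pairs_def)
      with j show ?thesis by (simp add: delta_def)
    next
      case False
      then show ?thesis
        using triangles_le[OF x, of "e i"] triangles_le[OF x, of "e (i + 1)"]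
        by (simp add: delta_def)
    qed
    moreover have "\<forall>i. 0 \<le> x $ i" using x by (simp add: triangles_def)
    ultimately show "x \<in> P_polytope e 1"
      unfolding P_polytope_def assms(1) nonneg by blast
  qed
qed

theorem theorem1p9:
  fixes r :: nat and e :: "nat \<Rightarrow> 'n::finite"
  assumes "r \<ge> 1"
    and "CARD('n) = 2 * r"
    and "bij_betw e {1..CARD('n)} UNIV"
  shows "gorenstein (P_polytope e 1) \<and>
    (\<exists>h. is_h_star_poly (P_polytope e 1) h \<and> palindromic_poly h)"
proof -
  have e: "bij_betw e {1..2 * r} UNIV" using assms(2,3) by simp
  interpret coordinate_pairing r "consecutive_pairs e"
    by (rule coordinate_pairing_consecutive[OF e])
  show ?thesis
    unfolding P_polytope_eq_triangles[OF assms(2) e]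
    using gorenstein_triangles h_star_triangles[OF assms(1)] by blast
qed

end
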